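(* Let $\mathbb{E}$ be a division ring, let $G$ be a finite subgroup of $\mathrm{Aut}(\mathbb{E})$ whose elements are pairwise distinct modulo the group $\mathrm{Inn}(\mathbb{E})$ of inner automorphisms, let $\mathbb{F}=\mathbb{E}^G$ be the sub-division ring of elements fixed by $G$, and let $d\ge1$. (1) Let $C\colon G\to\mathrm{GL}_d(\mathbb{E})$ be a 1-cocycle, and suppose that $C_\alpha=A\,\alpha(A)^{-1}$ for all $\alpha\in G$, where $A\in\mathrm{GL}_d(\mathbb{E})$ is upper-triangular. If $|\mathbb{F}|\ge d$, then there exists $\lambda\in\mathbb{E}$ such that $\Pi_C(I\lambda)$ is invertible. (2) Moreover, if $|\mathbb{F}|<d$, then there exists an upper-triangular matrix $A\in\mathrm{GL}_d(\mathbb{E})$ such that, with $C_\alpha=A\,\alpha(A)^{-1}$ for $\alpha\in G$, the matrix $\Pi_C(I\lambda)$ is singular for all $\lambda\in\mathbb{E}$.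
   Context: An automorphism $\alpha$ of $\mathbb{E}$ acts on $d\times d$ matrices over $\mathbb{E}$ entrywise; automorphisms act on the left and $\alpha\beta=\alpha\circ\beta$. "Distinct modulo $\mathrm{Inn}(\mathbb{E})$" means that if $\alpha,\beta\in G$ and $\alpha\beta^{-1}$ is an inner automorphism of $\mathbb{E}$, then $\alpha=\beta$. A map $C\colon G\to\mathrm{GL}_d(\mathbb{E})$, $\alpha\mapsto C_\alpha$, is a 1-cocycle if $C_{\alpha\beta}=C_\alpha\,\alpha(C_\beta)$ for all $\alpha,\beta\in G$; every map of the form $C_\alpha=A\alpha(A)^{-1}$ is one. For $X\in\mathbb{E}^{d\times d}$, $\Pi_C(X)=\sum_{\alpha\in G}C_\alpha\,\alpha(X)$, and $I\lambda$ is the scalar matrix with $\lambda$ on the diagonal. The condition $|\mathbb{F}|\ge d$ holds automatically if $\mathbb{F}$ is infinite.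
   Formalization: Part (2) is stated and proved only for nontrivial G; for trivial G it is false, since then C_id = I for every A and Π_C(Iλ) = Iλ is invertible at λ = 1 (e.g. E = F_2, d = 3). *)

theory Defs
  imports "Jordan_Normal_Form.Matrix"
begin

definition Aut :: "('a::division_ring \<Rightarrow> 'a) monoid"
  where "Aut = \<lparr>carrier = {\<alpha>. ring_isom \<alpha>}, mult = (\<circ>), one = id\<rparr>"

definition Inn :: "('a::division_ring \<Rightarrow> 'a) set"
  where "Inn = {\<alpha>. \<exists>u. u \<noteq> 0 \<and> \<alpha> = (\<lambda>x. u * x * inverse u)}"

definition distinct_mod_Inn :: "('a::division_ring \<Rightarrow> 'a) set \<Rightarrow> bool"
  where "distinct_mod_Inn G \<longleftrightarrow>
    (\<forall>\<alpha>\<in>G. \<forall>\<beta>\<in>G. \<alpha> \<otimes>\<^bsub>Aut\<^esub> inv\<^bsub>Aut\<^esub> \<beta> \<in> Inn \<longrightarrow> \<alpha> = \<beta>)"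

definition fixed_ring :: "('a::division_ring \<Rightarrow> 'a) set \<Rightarrow> 'a set"
  where "fixed_ring G = {x. \<forall>\<alpha>\<in>G. \<alpha> x = x}"

definition GL :: "nat \<Rightarrow> 'a::division_ring mat monoid"
  where "GL d = units_of (ring_mat TYPE('a) d ())"

definition one_cocycle ::
  "('a::division_ring \<Rightarrow> 'a) set \<Rightarrow> nat \<Rightarrow> (('a \<Rightarrow> 'a) \<Rightarrow> 'a mat) \<Rightarrow> bool"
  where "one_cocycle G d C \<longleftrightarrow>
    C \<in> G \<rightarrow> carrier (GL d) \<and>
    (\<forall>\<alpha>\<in>G. \<forall>\<beta>\<in>G. C (\<alpha> \<circ> \<beta>) = C \<alpha> * map_mat \<alpha> (C \<beta>))"

definition coboundary :: "nat \<Rightarrow> 'a::division_ring mat \<Rightarrow> ('a \<Rightarrow> 'a) \<Rightarrow> 'a mat"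
  where "coboundary d A = (\<lambda>\<alpha>. A * inv\<^bsub>GL d\<^esub> (map_mat \<alpha> A))"

definition twisted_trace ::
  "('a::division_ring \<Rightarrow> 'a) set \<Rightarrow> nat \<Rightarrow> (('a \<Rightarrow> 'a) \<Rightarrow> 'a mat) \<Rightarrow> 'a mat \<Rightarrow> 'a mat"
  where "twisted_trace G d C X =
    (\<Oplus>\<^bsub>ring_mat TYPE('a) d ()\<^esub>\<alpha>\<in>G. C \<alpha> * map_mat \<alpha> X)"

lemma group_Aut: "group (Aut :: ('a::division_ring \<Rightarrow> 'a) monoid)"
proof (rule groupI)
  fix \<alpha> \<beta> :: "'a \<Rightarrow> 'a"
  assume "\<alpha> \<in> carrier Aut" "\<beta> \<in> carrier Aut"
  then interpret a: ring_isom \<alpha> + b: ring_isom \<beta>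
    by (auto simp: Aut_def)
  have "surj (\<alpha> \<circ> \<beta>)"
    using a.surj b.surj by (metis comp_surj)
  then have "ring_isom (\<alpha> \<circ> \<beta>)"
    by unfold_locales (simp_all add: hom_distribs)
  then show "\<alpha> \<otimes>\<^bsub>Aut\<^esub> \<beta> \<in> carrier Aut"
    by (simp add: Aut_def)
next
  have "ring_isom (id :: 'a \<Rightarrow> 'a)"
    by unfold_locales auto
  then show "\<one>\<^bsub>Aut\<^esub> \<in> carrier (Aut :: ('a \<Rightarrow> 'a) monoid)"
    by (simp add: Aut_def)
next
  fix \<alpha> :: "'a \<Rightarrow> 'a"
  assume "\<alpha> \<in> carrier Aut"
  then interpret a: ring_isom \<alpha>
    by (auto simp: Aut_def)
  have "ring_isom (inv_into UNIV \<alpha>)"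
    by unfold_locales
  moreover have "inv_into UNIV \<alpha> \<circ> \<alpha> = id"
    by (simp add: fun_eq_iff)
  ultimately show "\<exists>\<beta>\<in>carrier Aut. \<beta> \<otimes>\<^bsub>Aut\<^esub> \<alpha> = \<one>\<^bsub>Aut\<^esub>"
    by (auto simp: Aut_def)
qed (auto simp: Aut_def o_assoc)

lemma group_GL: "group (GL d :: 'a::division_ring mat monoid)"
proof -
  interpret semiring "ring_mat TYPE('a) d ()"
    by (rule semiring_mat)
  show ?thesis
    unfolding GL_def by (rule units_group)
qed

lemma GL_simps:
  "carrier (GL d :: 'a::division_ring mat monoid) = Units (ring_mat TYPE('a) d ())"
  "mult (GL d :: 'a mat monoid) = (*)"
  "one (GL d :: 'a mat monoid) = 1\<^sub>m d"
  by (simp_all add: GL_def units_of_def ring_mat_def)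

text \<open>For the trivial group every such sum is the scalar matrix itself, which is invertible for
  a nonzero scalar, however small the fixed ring is. A singular example over a small fixed ring
  therefore exists only for a nontrivial group.\<close>

lemma twisted_trace_trivial_group:
  fixes A :: "'a::division_ring mat"
  assumes A: "A \<in> carrier (GL d)"
  shows "twisted_trace {id} d (coboundary d A) (l \<cdot>\<^sub>m 1\<^sub>m d) = l \<cdot>\<^sub>m 1\<^sub>m d"
proof -
  interpret R: semiring "ring_mat TYPE('a) d ()"
    by (rule semiring_mat)
  interpret GL: group "GL d :: 'a mat monoid"
    by (rule group_GL)
  have id: "map_mat id B = B" for B :: "'a mat"
    by (rule eq_matI) auto
  have "A * inv\<^bsub>GL d\<^esub> A = 1\<^sub>m d"
    using GL.r_inv[OF A] by (simp add: GL_simps)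
  then show ?thesis
    by (simp add: twisted_trace_def coboundary_def id ring_mat_simps)
qed

end

theory Submission
  imports Defs
begin

text \<open>Write $\mathrm{tr}(x) = \sum_{\alpha \in G} \alpha(x)$, applied entrywise to matrices. For
  $C_\alpha = A\,\alpha(A)^{-1}$ one has $\Pi_C(I\lambda) = A\,\mathrm{tr}(A^{-1}\lambda)$, and
  for upper-triangular $A$ the second factor is upper-triangular with diagonal entries
  $\mathrm{tr}(a_{ii}^{-1}\lambda)$. So $\Pi_C(I\lambda)$ is invertible iff $\lambda$ avoids the
  kernels of the $d$ right $\mathbb{F}$-linear functionals $\mathrm{tr}(a_{ii}^{-1}\,\cdot\,)$. These
  are nonzero by Dedekind independence modulo inner automorphisms, and a right vector space over
  $\mathbb{F}$ is not a union of $d \le |\mathbb{F}|$ proper subspaces. Conversely, if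
  $|\mathbb{F}| < d$ and $x \notin \mathbb{F}$, the at most $d$ functionals
  $\mathrm{tr}(\,\cdot\,)$ and $\mathrm{tr}((x + f)\,\cdot\,)$ with $f \in \mathbb{F}$ have kernels
  covering $\mathbb{E}$: take $f = -\mathrm{tr}(x\lambda)\,\mathrm{tr}(\lambda)^{-1}$.\<close>

section \<open>Dedekind independence modulo inner automorphisms\<close>

text \<open>Artin's shortening argument, by induction on the set of maps. Over a noncommutative
  ring, eliminating one map \<beta> from a relation leaves coefficients that vanish only if some
  \<open>k\<close> satisfies \<open>k * \<alpha> y = \<beta> y * k\<close> for all \<open>y\<close>.
  For nonzero \<open>k\<close> this says that \<beta> is \<alpha> followed by conjugation with
  \<open>k\<close>, which the assumption on \<open>u\<close> excludes for distinct maps.\<close>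

lemma twisted_hom_independent:
  fixes S :: "('b::monoid_mult \<Rightarrow> 'a::division_ring) set" and c :: "('b \<Rightarrow> 'a) \<Rightarrow> 'a"
  assumes "finite S"
    and "\<And>\<alpha> x y. \<alpha> \<in> S \<Longrightarrow> \<alpha> (x * y) = \<alpha> x * \<alpha> y"
    and "\<And>\<alpha>. \<alpha> \<in> S \<Longrightarrow> \<alpha> 1 = 1"
    and "\<And>\<alpha> \<beta> u. \<alpha> \<in> S \<Longrightarrow> \<beta> \<in> S \<Longrightarrow> u \<noteq> 0 \<Longrightarrow> \<forall>y. u * \<alpha> y = \<beta> y * u \<Longrightarrow> \<alpha> = \<beta>"
    and "\<And>x. (\<Sum>\<alpha>\<in>S. c \<alpha> * \<alpha> x) = 0"
    and "\<gamma> \<in> S"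
  shows "c \<gamma> = 0"
  using assms
proof (induction S arbitrary: c \<gamma> rule: finite_induct)
  case empty
  then show ?case by simp
next
  case (insert \<beta> S)
  note mult = insert.prems(1) and one = insert.prems(2) and dist = insert.prems(3)
    and rel = insert.prems(4)
  have IH: "c' \<alpha> = 0" if "\<And>x. (\<Sum>\<alpha>\<in>S. c' \<alpha> * \<alpha> x) = 0" "\<alpha> \<in> S" for c' \<alpha>
  proof (rule insert.IH[OF _ _ _ that])
    fix \<alpha> assume "\<alpha> \<in> S"
    then show "\<alpha> 1 = 1" "\<alpha> (x * y) = \<alpha> x * \<alpha> y" for x y
      using mult one by auto
  next
    fix \<alpha> \<beta> u assume "\<alpha> \<in> S" "\<beta> \<in> S" "u \<noteq> (0::'a)" "\<forall>y. u * \<alpha> y = \<beta> y * u"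
    then show "\<alpha> = \<beta>"
      using dist[of \<alpha> \<beta> u] by auto
  qed
  have c\<beta>: "c \<beta> = 0"
  proof (rule ccontr)
    assume nz: "c \<beta> \<noteq> 0"
    \<comment> \<open>Left multiplication normalises the coefficient of \<beta> to 1, so that a left
      multiple by \<open>\<beta> y\<close> can cancel \<open>\<beta> (y * x)\<close>.\<close>
    define k where "k \<alpha> = inverse (c \<beta>) * c \<alpha>" for \<alpha>
    have k\<beta>: "k \<beta> = 1"
      using nz by (simp add: k_def)
    have krel: "\<beta> x + (\<Sum>\<alpha>\<in>S. k \<alpha> * \<alpha> x) = 0" for x
    proof -
      have "(\<Sum>\<alpha>\<in>insert \<beta> S. k \<alpha> * \<alpha> x) = inverse (c \<beta>) * (\<Sum>\<alpha>\<in>insert \<beta> S. c \<alpha> * \<alpha> x)"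
        unfolding sum_distrib_left by (simp add: k_def mult.assoc)
      then show ?thesis
        using rel[of x] insert.hyps k\<beta> by simp
    qed
    \<comment> \<open>Substituting $yx$ for $x$ and subtracting $\beta(y)$ times the relation eliminates $\beta$.\<close>
    have step: "k \<alpha> * \<alpha> y - \<beta> y * k \<alpha> = 0" if "\<alpha> \<in> S" for \<alpha> y
    proof (rule IH[OF _ that])
      fix x
      have "(\<Sum>\<alpha>\<in>S. (k \<alpha> * \<alpha> y - \<beta> y * k \<alpha>) * \<alpha> x)
          = (\<Sum>\<alpha>\<in>S. k \<alpha> * \<alpha> (y * x)) - \<beta> y * (\<Sum>\<alpha>\<in>S. k \<alpha> * \<alpha> x)"
        unfolding sum_distrib_left sum_subtractf[symmetric]
        by (rule sum.cong) (simp_all add: mult algebra_simps)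
      also have "\<dots> = - \<beta> (y * x) - \<beta> y * (- \<beta> x)"
        using krel[of x] krel[of "y * x"] by (metis add_eq_0_iff)
      finally show "(\<Sum>\<alpha>\<in>S. (k \<alpha> * \<alpha> y - \<beta> y * k \<alpha>) * \<alpha> x) = 0"
        by (simp add: mult)
    qed
    \<comment> \<open>A nonzero \<open>k \<alpha>\<close> would intertwine \<alpha> and \<beta> and
      force \<alpha> = \<beta>, although \<beta> is not in \<open>S\<close>. The relation at 1 then
      contradicts \<open>\<beta> 1 = 1\<close>.\<close>
    have "k \<alpha> = 0" if "\<alpha> \<in> S" for \<alpha>
      using dist[of \<alpha> \<beta> "k \<alpha>"] step[OF that] that insert.hyps by auto
    then have "\<beta> 1 = 0"
      using krel[of 1] by simp
    then show False
      using one[of \<beta>] by simp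
  qed
  then have "(\<Sum>\<alpha>\<in>S. c \<alpha> * \<alpha> x) = 0" for x
    using rel[of x] insert.hyps by simp
  then show ?case
    using IH[of c] c\<beta> insert.prems(5) by blast
qed

section \<open>Avoiding the kernels of finitely many functionals\<close>

text \<open>Induction on the number of functionals: a point \<open>l\<close> that is good for the
  first \<open>k\<close> but killed by the next one still serves as the direction of a line through
  a point \<open>m\<close> not killed by it. Since \<open>card\<close> is 0 on infinite sets, the
  infinite case is a disjunct of its own.\<close>

lemma avoid_hyperplanes:
  fixes T :: "'a::division_ring \<Rightarrow> 'a" and a :: "nat \<Rightarrow> 'a"
  assumes add: "\<And>x y. T (x + y) = T x + T y"
    and lin: "\<And>x f. f \<in> F \<Longrightarrow> T (x * f) = T x * f"
    and nz: "\<And>i. i < d \<Longrightarrow> \<exists>x. T (a i * x) \<noteq> 0"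
    and F: "infinite F \<or> card F \<ge> d"
  shows "\<exists>l. \<forall>i<d. T (a i * l) \<noteq> 0"
proof -
  have "k \<le> d \<Longrightarrow> \<exists>l. \<forall>i<k. T (a i * l) \<noteq> 0" for k
  proof (induction k)
    case 0
    then show ?case by simp
  next
    case (Suc k)
    then obtain l where l: "\<And>i. i < k \<Longrightarrow> T (a i * l) \<noteq> 0"
      by auto
    show ?case
    proof (cases "T (a k * l) = 0")
      case False
      then show ?thesis
        using l less_Suc_eq by auto
    next
      case True
      obtain m where m: "T (a k * m) \<noteq> 0"
        using nz[of k] Suc.prems by auto
      \<comment> \<open>On the line $m + l f$ the $k$-th functional is constant and nonzero, and each earlier
        one vanishes for a single $f$.\<close>
      define bad where "bad = (\<lambda>i. - (inverse (T (a i * l)) * T (a i * m))) ` {..<k}"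
      have "card bad \<le> k"
        unfolding bad_def using card_image_le[of "{..<k}"] by simp
      \<comment> \<open>The size of \<open>F\<close> enters here: there are at most \<open>k\<close>
        bad values, and \<open>k < d\<close>.\<close>
      have "\<not> F \<subseteq> bad"
      proof
        assume *: "F \<subseteq> bad"
        have fin: "finite bad"
          by (simp add: bad_def)
        then have "finite F" "card F \<le> card bad"
          using * by (auto intro: finite_subset card_mono)
        with \<open>card bad \<le> k\<close> F Suc.prems show False
          by simp
      qed
      then obtain f where f: "f \<in> F" "f \<notin> bad"
        by auto
      have T: "T (a i * (m + l * f)) = T (a i * m) + T (a i * l) * f" for i
        using lin[OF f(1), of "a i * l"] by (simp add: distrib_left add mult.assoc)
      have "T (a i * (m + l * f)) \<noteq> 0" if "i < Suc k" for i
      proof (cases "i = k")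
        case True
        then show ?thesis
          using T m \<open>T (a k * l) = 0\<close> by simp
      next
        case False
        then have i: "i < k"
          using that by simp
        show ?thesis
        proof
          assume "T (a i * (m + l * f)) = 0"
          then have "T (a i * l) * f = - T (a i * m)"
            using T[of i] by (metis add_eq_0_iff)
          then have "inverse (T (a i * l)) * (T (a i * l) * f) = - (inverse (T (a i * l)) * T (a i * m))"
            by simp
          then have "f = - (inverse (T (a i * l)) * T (a i * m))"
            using l[OF i] by (simp add: mult.assoc[symmetric])
          then show False
            using f(2) i by (auto simp: bad_def)
        qed
      qed
      then show ?thesis
        by blast
    qed
  qed
  then show ?thesis
    by blast
qed

section \<open>Triangular matrices over a division ring\<close>

text \<open>In place of determinants, \<open>B * A = 1\<close> is read column by column from the
  left: once the earlier columns of \<open>B\<close> are known to vanish below the diagonal, column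
  \<open>j\<close> involves a single product.\<close>

lemma upper_triangular_left_inverse:
  fixes A B :: "'a::division_ring mat"
  assumes A: "A \<in> carrier_mat d d" and B: "B \<in> carrier_mat d d"
    and tri: "upper_triangular A" and inv: "B * A = 1\<^sub>m d" and "j < d"
  shows "A $$ (j,j) \<noteq> 0" and "B $$ (j,j) = inverse (A $$ (j,j))"
    and "\<And>i. j < i \<Longrightarrow> i < d \<Longrightarrow> B $$ (i,j) = 0"
proof -
  have "j < d \<longrightarrow> A $$ (j,j) \<noteq> 0 \<and> B $$ (j,j) = inverse (A $$ (j,j)) \<and>
      (\<forall>i. j < i \<longrightarrow> i < d \<longrightarrow> B $$ (i,j) = 0)" for j
  proof (induction j rule: less_induct)
    case (less j)
    show ?case
    proof
      assume j: "j < d"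
      \<comment> \<open>For \<open>k < j \<le> i\<close> the factor \<open>B $$ (i,k)\<close>
        vanishes by induction, and for \<open>k > j\<close> the factor \<open>A $$ (k,j)\<close>
        vanishes by triangularity. Only \<open>k = j\<close> survives.\<close>
      have entry: "B $$ (i,j) * A $$ (j,j) = (if i = j then 1 else 0)" if i: "j \<le> i" "i < d" for i
      proof -
        have "(B * A) $$ (i,j) = (\<Sum>k = 0..<d. B $$ (i,k) * A $$ (k,j))"
          using i j A B by (simp add: scalar_prod_def)
        also have "\<dots> = (\<Sum>k = 0..<d. if k = j then B $$ (i,j) * A $$ (j,j) else 0)"
        proof (rule sum.cong)
          fix k assume k: "k \<in> {0..<d}"
          consider "k < j" | "k = j" | "j < k"
            by linarith
          then show "B $$ (i,k) * A $$ (k,j) = (if k = j then B $$ (i,j) * A $$ (j,j) else 0)"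
          proof cases
            case 1
            then show ?thesis using less.IH[of k] i j by simp
          next
            case 3
            then show ?thesis using upper_triangularD[OF tri, of j k] k A by simp
          qed simp
        qed simp
        finally show ?thesis
          using i j inv by simp
      qed
      have nz: "A $$ (j,j) \<noteq> 0"
        using entry[of j] j by auto
      moreover have "B $$ (j,j) = inverse (A $$ (j,j))"
        using entry[of j] j nz by (metis inverse_unique inverse_inverse_eq order_refl)
      moreover have "B $$ (i,j) = 0" if "j < i" "i < d" for i
        using entry[of i] that nz by simp
      ultimately show "A $$ (j,j) \<noteq> 0 \<and> B $$ (j,j) = inverse (A $$ (j,j)) \<and>
          (\<forall>i. j < i \<longrightarrow> i < d \<longrightarrow> B $$ (i,j) = 0)"
        by blast
    qed
  qed
  then show "A $$ (j,j) \<noteq> 0" "B $$ (j,j) = inverse (A $$ (j,j))"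
    "\<And>i. j < i \<Longrightarrow> i < d \<Longrightarrow> B $$ (i,j) = 0"
    using \<open>j < d\<close> by auto
qed

text \<open>Induction on the size, splitting off the first row and column. With diagonal blocks
  \<open>P\<close>, \<open>S\<close> and upper right block \<open>Q\<close>, the inverse has
  diagonal blocks \<open>X = P^-1\<close>, \<open>Y = S^-1\<close> and upper right block
  \<open>- X * Q * Y\<close>.\<close>

lemma upper_triangular_inverse_exists:
  fixes A :: "'a::division_ring mat"
  assumes "A \<in> carrier_mat d d" and "upper_triangular A" and "\<And>i. i < d \<Longrightarrow> A $$ (i,i) \<noteq> 0"
  shows "\<exists>B\<in>carrier_mat d d. B * A = 1\<^sub>m d \<and> A * B = 1\<^sub>m d"
  using assms
proof (induction d arbitrary: A)
  case 0
  then show ?case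
    by (intro bexI[of _ "1\<^sub>m 0"]) (auto intro!: eq_matI)
next
  case (Suc d)
  obtain P Q R S where PQRS: "split_block A 1 1 = (P,Q,R,S)"
    by (metis prod_cases4)
  note split = split_block[OF PQRS, of d d]
  have P: "P \<in> carrier_mat 1 1" and Q: "Q \<in> carrier_mat 1 d" and S: "S \<in> carrier_mat d d"
    and R': "R \<in> carrier_mat d 1" and A: "A = four_block_mat P Q R S"
    using split Suc.prems(1) by auto
  have Sij: "S $$ (i,j) = A $$ (Suc i, Suc j)" if "i < d" "j < d" for i j
    using that P S A by simp
  have R: "R = 0\<^sub>m d 1"
  proof (rule eq_matI)
    fix i j assume ij: "i < dim_row (0\<^sub>m d 1 :: 'a mat)" "j < dim_col (0\<^sub>m d 1 :: 'a mat)"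
    then have "R $$ (i,j) = A $$ (Suc i, 0)"
      using P Q R' S A by simp
    also have "\<dots> = 0"
      using upper_triangularD[OF Suc.prems(2), of 0 "Suc i"] ij Suc.prems(1) by simp
    finally show "R $$ (i,j) = 0\<^sub>m d 1 $$ (i,j)"
      using ij by simp
  qed (use R' in auto)
  have p: "P $$ (0,0) \<noteq> 0"
    using Suc.prems(3)[of 0] P S A by simp
  have "upper_triangular S"
    using Suc.prems(1,2) S Sij by (intro upper_triangularI) auto
  moreover have "S $$ (i,i) \<noteq> 0" if "i < d" for i
    using Suc.prems(3)[of "Suc i"] that Sij by simp
  ultimately obtain Y where Y: "Y \<in> carrier_mat d d" "Y * S = 1\<^sub>m d" "S * Y = 1\<^sub>m d"
    using Suc.IH[OF S] by blast
  define X where "X = mat 1 1 (\<lambda>_. inverse (P $$ (0,0)))"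
  have X: "X \<in> carrier_mat 1 1"
    by (simp add: X_def)
  have XP: "X * P = 1\<^sub>m 1" "P * X = 1\<^sub>m 1"
    using P p by (auto intro!: eq_matI simp: X_def scalar_prod_def)
  \<comment> \<open>This choice satisfies \<open>W * S = X * Q\<close> and
    \<open>P * W = Q * Y\<close>, which cancel the upper right blocks of \<open>B * A\<close> and
    \<open>A * B\<close> respectively.\<close>
  define W where "W = X * Q * Y"
  have W: "W \<in> carrier_mat 1 d"
    using X Q Y unfolding W_def by auto
  have WS: "W * S = X * Q"
    unfolding W_def using assoc_mult_mat[OF mult_carrier_mat[OF X Q] Y(1) S] Y(2)
      right_mult_one_mat[OF mult_carrier_mat[OF X Q]] by simp
  have PW: "P * W = Q * Y"
  proof -
    have "P * W = (P * X) * (Q * Y)"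
      unfolding W_def using X P Q S Y by (simp add: assoc_mult_mat[of _ 1 1 _ d _ d] assoc_mult_mat[of _ 1 1 _ 1 _ d])
    then show ?thesis
      using XP Q Y by (metis left_mult_one_mat mult_carrier_mat)
  qed
  define B where "B = four_block_mat X (- W) (0\<^sub>m d 1) Y"
  have B: "B \<in> carrier_mat (Suc d) (Suc d)"
    using four_block_carrier_mat[OF X Y(1)] unfolding B_def by simp
  have one: "four_block_mat (1\<^sub>m 1) (0\<^sub>m 1 d) (0\<^sub>m d 1) (1\<^sub>m d) = (1\<^sub>m (Suc d) :: 'a mat)"
    using four_block_one_mat[of 1 d] by simp
  have nW: "- W \<in> carrier_mat 1 d"
    using W by simp
  have z: "0\<^sub>m d 1 \<in> carrier_mat d (1::nat)"
    by simp
  have "B * A = 1\<^sub>m (Suc d)"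
  proof -
    have XQ: "X * Q \<in> carrier_mat 1 d"
      using X Q by auto
    have "B * A = four_block_mat (X * P + - W * 0\<^sub>m d 1) (X * Q + - W * S)
        (0\<^sub>m d 1 * P + Y * 0\<^sub>m d 1) (0\<^sub>m d 1 * Q + Y * S)"
      unfolding A R B_def by (rule mult_four_block_mat[OF X nW z Y(1) P Q z S])
    also have "\<dots> = four_block_mat (1\<^sub>m 1) (0\<^sub>m 1 d) (0\<^sub>m d 1) (1\<^sub>m d)"
    proof -
      have "X * P + - W * 0\<^sub>m d 1 = 1\<^sub>m 1"
        using XP nW by simp
      moreover have "X * Q + - W * S = 0\<^sub>m 1 d"
        using WS XQ W S by (simp add: add_uminus_minus_mat)
      ultimately show ?thesis
        using P Q Y by simp
    qed
    finally show ?thesis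
      using one by simp
  qed
  moreover have "A * B = 1\<^sub>m (Suc d)"
  proof -
    have QY: "Q * Y \<in> carrier_mat 1 d"
      using Y Q by auto
    have "A * B = four_block_mat (P * X + Q * 0\<^sub>m d 1) (P * (- W) + Q * Y)
        (0\<^sub>m d 1 * X + S * 0\<^sub>m d 1) (0\<^sub>m d 1 * (- W) + S * Y)"
      unfolding A R B_def by (rule mult_four_block_mat[OF P Q z S X nW z Y(1)])
    also have "\<dots> = four_block_mat (1\<^sub>m 1) (0\<^sub>m 1 d) (0\<^sub>m d 1) (1\<^sub>m d)"
    proof -
      have "P * X + Q * 0\<^sub>m d 1 = 1\<^sub>m 1"
        using XP Q by simp
      moreover have "P * (- W) + Q * Y = 0\<^sub>m 1 d"
        using PW QY W P by simp
      moreover have "0\<^sub>m d 1 * (- W) + S * Y = 1\<^sub>m d"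
        using Y left_mult_zero_mat[OF nW, of d] by (simp del: uminus_mult_right_mat)
      ultimately show ?thesis
        using X S by simp
    qed
    finally show ?thesis
      using one by simp
  qed
  ultimately show ?case
    using B by blast
qed

section \<open>Units of the matrix ring and entrywise automorphisms\<close>

lemma GL_iff:
  fixes A :: "'a::division_ring mat"
  shows "A \<in> carrier (GL d) \<longleftrightarrow>
    A \<in> carrier_mat d d \<and> (\<exists>B\<in>carrier_mat d d. B * A = 1\<^sub>m d \<and> A * B = 1\<^sub>m d)"
  unfolding GL_simps Units_def by (simp add: ring_mat_simps)

lemma upper_triangular_GL_iff:
  fixes A :: "'a::division_ring mat"
  assumes A: "A \<in> carrier_mat d d" and tri: "upper_triangular A"
  shows "A \<in> carrier (GL d) \<longleftrightarrow> (\<forall>i<d. A $$ (i,i) \<noteq> 0)"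
  using upper_triangular_left_inverse(1)[OF A _ tri] upper_triangular_inverse_exists[OF A tri] A
  unfolding GL_iff by blast

lemma GL_inverse:
  fixes A :: "'a::division_ring mat"
  assumes "A \<in> carrier (GL d)"
  shows "inv\<^bsub>GL d\<^esub> A \<in> carrier_mat d d" and "inv\<^bsub>GL d\<^esub> A * A = 1\<^sub>m d"
    and "A * inv\<^bsub>GL d\<^esub> A = 1\<^sub>m d"
proof -
  interpret GL: group "GL d :: 'a mat monoid"
    by (rule group_GL)
  show "inv\<^bsub>GL d\<^esub> A \<in> carrier_mat d d"
    using GL.inv_closed[OF assms] GL_iff by blast
  show "inv\<^bsub>GL d\<^esub> A * A = 1\<^sub>m d" "A * inv\<^bsub>GL d\<^esub> A = 1\<^sub>m d"
    using GL.l_inv[OF assms] GL.r_inv[OF assms] by (simp_all add: GL_simps)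
qed

text \<open>An entrywise automorphism is a homomorphism of matrix rings and so preserves both
  inverse equations. This rewrites the coboundary as \<open>A\<close> times \<alpha> applied to the
  inverse of \<open>A\<close>.\<close>

lemma map_mat_inv_GL:
  fixes A :: "'a::division_ring mat"
  assumes \<alpha>: "\<alpha> \<in> carrier Aut" and A: "A \<in> carrier (GL d)"
  shows "inv\<^bsub>GL d\<^esub> (map_mat \<alpha> A) = map_mat \<alpha> (inv\<^bsub>GL d\<^esub> A)"
proof -
  interpret \<alpha>: ring_isom \<alpha>
    using \<alpha> by (simp add: Aut_def)
  interpret GL: group "GL d :: 'a mat monoid"
    by (rule group_GL)
  have Ac: "A \<in> carrier_mat d d"
    using A GL_iff by blast
  have l: "map_mat \<alpha> (inv\<^bsub>GL d\<^esub> A) * map_mat \<alpha> A = 1\<^sub>m d"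
    using \<alpha>.mat_hom_mult[OF GL_inverse(1)[OF A] Ac] GL_inverse(2)[OF A] \<alpha>.mat_hom_one by simp
  have r: "map_mat \<alpha> A * map_mat \<alpha> (inv\<^bsub>GL d\<^esub> A) = 1\<^sub>m d"
    using \<alpha>.mat_hom_mult[OF Ac GL_inverse(1)[OF A]] GL_inverse(3)[OF A] \<alpha>.mat_hom_one by simp
  have "map_mat \<alpha> A \<in> carrier (GL d)" "map_mat \<alpha> (inv\<^bsub>GL d\<^esub> A) \<in> carrier (GL d)"
    unfolding GL_iff using l r Ac GL_inverse(1)[OF A] by auto
  then show ?thesis
    using GL.inv_equality[of "map_mat \<alpha> (inv\<^bsub>GL d\<^esub> A)" "map_mat \<alpha> A"] l by (simp add: GL_simps)
qed

section \<open>Twisted sums of coboundaries\<close>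

text \<open>Passes from the sum in the ring record, as in \<open>twisted_trace\<close>, to ordinary
  sums of entries.\<close>

lemma finsum_ring_mat_map_mat:
  fixes f :: "'b \<Rightarrow> 'a::semiring_1 \<Rightarrow> 'a"
  assumes "finite S" and X: "X \<in> carrier_mat d d"
  shows "(\<Oplus>\<^bsub>ring_mat TYPE('a) d ()\<^esub>\<alpha>\<in>S. map_mat (f \<alpha>) X) = map_mat (\<lambda>x. \<Sum>\<alpha>\<in>S. f \<alpha> x) X"
  using \<open>finite S\<close>
proof (induction S rule: finite_induct)
  case empty
  interpret R: semiring "ring_mat TYPE('a) d ()"
    by (rule semiring_mat)
  show ?case
    using X by (auto intro!: eq_matI simp: ring_mat_simps)
next
  case (insert \<beta> S)
  interpret R: semiring "ring_mat TYPE('a) d ()"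
    by (rule semiring_mat)
  have "(\<lambda>\<alpha>. map_mat (f \<alpha>) X) \<in> S \<rightarrow> carrier (ring_mat TYPE('a) d ())"
    "map_mat (f \<beta>) X \<in> carrier (ring_mat TYPE('a) d ())"
    using X by (auto simp: ring_mat_simps)
  from R.finsum_insert[OF insert.hyps this] show ?case
    using X insert.hyps insert.IH by (auto intro!: eq_matI simp: ring_mat_simps)
qed

text \<open>Each summand \<open>A * \<alpha>(A)^-1 * \<alpha>(X)\<close> equals
  \<open>A * \<alpha>(A^-1 * X)\<close>, and the common left factor \<open>A\<close> comes out of
  the sum.\<close>

lemma twisted_trace_coboundary:
  fixes A X :: "'a::division_ring mat"
  assumes G: "G \<subseteq> carrier Aut" "finite G" and A: "A \<in> carrier (GL d)"
    and X: "X \<in> carrier_mat d d"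
  shows "twisted_trace G d (coboundary d A) X
    = A * map_mat (\<lambda>x. \<Sum>\<alpha>\<in>G. \<alpha> x) (inv\<^bsub>GL d\<^esub> A * X)"
proof -
  interpret R: semiring "ring_mat TYPE('a) d ()"
    by (rule semiring_mat)
  let ?B = "inv\<^bsub>GL d\<^esub> A"
  note B = GL_inverse(1)[OF A]
  have Ac: "A \<in> carrier_mat d d"
    using A GL_iff by blast
  have BX: "?B * X \<in> carrier_mat d d"
    using B X by simp
  have "coboundary d A \<alpha> * map_mat \<alpha> X = A * map_mat \<alpha> (?B * X)" if "\<alpha> \<in> G" for \<alpha>
  proof -
    have \<alpha>: "\<alpha> \<in> carrier Aut"
      using that G by blast
    interpret \<alpha>: ring_isom \<alpha>
      using \<alpha> by (simp add: Aut_def)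
    have "coboundary d A \<alpha> * map_mat \<alpha> X = A * (map_mat \<alpha> ?B * map_mat \<alpha> X)"
      unfolding coboundary_def map_mat_inv_GL[OF \<alpha> A]
      using Ac B X by (intro assoc_mult_mat) auto
    then show ?thesis
      using \<alpha>.mat_hom_mult[OF B X] by simp
  qed
  then have "twisted_trace G d (coboundary d A) X
      = (\<Oplus>\<^bsub>ring_mat TYPE('a) d ()\<^esub>\<alpha>\<in>G. A * map_mat \<alpha> (?B * X))"
    unfolding twisted_trace_def using Ac BX
    by (intro R.finsum_cong') (auto simp: ring_mat_simps)
  also have "\<dots> = A * (\<Oplus>\<^bsub>ring_mat TYPE('a) d ()\<^esub>\<alpha>\<in>G. map_mat \<alpha> (?B * X))"
    using R.finsum_rdistr[of G A "\<lambda>\<alpha>. map_mat \<alpha> (?B * X)"] G(2) Ac BX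
    by (auto simp: ring_mat_simps)
  also have "\<dots> = A * map_mat (\<lambda>x. \<Sum>\<alpha>\<in>G. \<alpha> x) (?B * X)"
    using finsum_ring_mat_map_mat[OF G(2) BX, of "\<lambda>\<alpha>. \<alpha>"] by simp
  finally show ?thesis .
qed

lemma twisted_trace_scalar_GL_iff:
  fixes A :: "'a::division_ring mat"
  assumes G: "G \<subseteq> carrier Aut" "finite G" and A: "A \<in> carrier (GL d)" "upper_triangular A"
  shows "twisted_trace G d (coboundary d A) (l \<cdot>\<^sub>m 1\<^sub>m d) \<in> carrier (GL d)
    \<longleftrightarrow> (\<forall>i<d. (\<Sum>\<alpha>\<in>G. \<alpha> (inverse (A $$ (i,i)) * l)) \<noteq> 0)"
proof -
  interpret GL: group "GL d :: 'a mat monoid"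
    by (rule group_GL)
  let ?B = "inv\<^bsub>GL d\<^esub> A" and ?tr = "\<lambda>x. \<Sum>\<alpha>\<in>G. \<alpha> x"
  define T where "T = map_mat ?tr (?B * (l \<cdot>\<^sub>m 1\<^sub>m d))"
  have Ac: "A \<in> carrier_mat d d"
    using A GL_iff by blast
  note B = GL_inverse(1,2)[OF A(1)]
  have Tc: "T \<in> carrier_mat d d"
    using B by (simp add: T_def)
  \<comment> \<open>The scalar matrix multiplies each entry of the inverse by \<open>l\<close> on
    the right.\<close>
  have T: "T $$ (i,j) = ?tr (?B $$ (i,j) * l)" if "i < d" "j < d" for i j
  proof -
    have "(?B * (l \<cdot>\<^sub>m 1\<^sub>m d)) $$ (i,j) = (\<Sum>k = 0..<d. ?B $$ (i,k) * (l * (if k = j then 1 else 0)))"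
      using that B by (simp add: scalar_prod_def)
    also have "\<dots> = (\<Sum>k = 0..<d. if k = j then ?B $$ (i,j) * l else 0)"
      by (rule sum.cong) auto
    finally show ?thesis
      using that B by (simp add: T_def)
  qed
  \<comment> \<open>Needed so that the zeros below the diagonal of the inverse of \<open>A\<close>
    remain zeros after the trace.\<close>
  have "?tr 0 = 0"
  proof (rule sum.neutral, rule ballI)
    fix \<alpha> assume "\<alpha> \<in> G"
    then interpret \<alpha>: ring_isom \<alpha>
      using G by (auto simp: Aut_def)
    show "\<alpha> 0 = 0"
      by simp
  qed
  then have tri: "upper_triangular T"
    using upper_triangular_left_inverse(3)[OF Ac B(1) A(2) B(2)] T Tc
    by (intro upper_triangularI) auto
  have eq: "twisted_trace G d (coboundary d A) (l \<cdot>\<^sub>m 1\<^sub>m d) = A * T"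
    unfolding T_def by (rule twisted_trace_coboundary[OF G A(1)]) simp
  have "A * T \<in> carrier (GL d) \<longleftrightarrow> T \<in> carrier (GL d)"
  proof
    assume "A * T \<in> carrier (GL d)"
    then have "?B * (A * T) \<in> carrier (GL d)"
      using GL.m_closed[OF GL.inv_closed[OF A(1)]] by (simp add: GL_simps)
    moreover have "?B * (A * T) = T"
      using assoc_mult_mat[OF B(1) Ac Tc] B(2) Tc by simp
    ultimately show "T \<in> carrier (GL d)"
      by simp
  next
    assume "T \<in> carrier (GL d)"
    then show "A * T \<in> carrier (GL d)"
      using GL.m_closed[OF A(1)] by (simp add: GL_simps)
  qed
  also have "\<dots> \<longleftrightarrow> (\<forall>i<d. T $$ (i,i) \<noteq> 0)"
    by (rule upper_triangular_GL_iff[OF Tc tri])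
  also have "\<dots> \<longleftrightarrow> (\<forall>i<d. ?tr (inverse (A $$ (i,i)) * l) \<noteq> 0)"
    using T upper_triangular_left_inverse(2)[OF Ac B(1) A(2) B(2)] by simp
  finally show ?thesis
    using eq by simp
qed

section \<open>The trace of the group and its fixed ring\<close>

text \<open>Brings distinctness into the intertwining form used for independence: putting
  \<open>y = \<alpha>^-1 z\<close> turns the relation into
  \<open>\<beta> (\<alpha>^-1 z) = u * z * u^-1\<close>.\<close>

lemma distinct_mod_InnD:
  fixes G :: "('a::division_ring \<Rightarrow> 'a) set"
  assumes dist: "distinct_mod_Inn G" and G: "G \<subseteq> carrier Aut"
    and \<alpha>: "\<alpha> \<in> G" and \<beta>: "\<beta> \<in> G" and u: "u \<noteq> 0" "\<forall>y. u * \<alpha> y = \<beta> y * u"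
  shows "\<alpha> = \<beta>"
proof -
  interpret Aut: group "Aut :: ('a \<Rightarrow> 'a) monoid"
    by (rule group_Aut)
  let ?\<alpha>' = "inv\<^bsub>Aut\<^esub> \<alpha>"
  have "\<alpha> \<circ> ?\<alpha>' = id"
    using Aut.r_inv[of \<alpha>] \<alpha> G by (auto simp: Aut_def)
  then have "\<alpha> (?\<alpha>' z) = z" for z
    by (metis comp_apply id_apply)
  then have "\<beta> (?\<alpha>' z) = u * z * inverse u" for z
    using u by (metis mult.assoc mult.right_neutral right_inverse)
  then have "\<beta> \<otimes>\<^bsub>Aut\<^esub> ?\<alpha>' = (\<lambda>x. u * x * inverse u)"
    by (auto simp: Aut_def)
  then have "\<beta> \<otimes>\<^bsub>Aut\<^esub> ?\<alpha>' \<in> Inn"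
    using u(1) unfolding Inn_def by blast
  then show ?thesis
    using dist \<alpha> \<beta> unfolding distinct_mod_Inn_def by blast
qed

text \<open>As \<open>a\<close> is invertible, \<open>a * x\<close> runs through the whole ring.
  Vanishing would thus be a relation among the elements of \<open>G\<close> with all coefficients
  1.\<close>

lemma trace_nonzero:
  fixes G :: "('a::division_ring \<Rightarrow> 'a) set"
  assumes "G \<subseteq> carrier Aut" and "finite G" and "distinct_mod_Inn G" and "G \<noteq> {}" and "a \<noteq> 0"
  shows "\<exists>x. (\<Sum>\<alpha>\<in>G. \<alpha> (a * x)) \<noteq> 0"
proof (rule ccontr)
  assume "\<not> ?thesis"
  then have zero: "(\<Sum>\<alpha>\<in>G. \<alpha> x) = 0" for x
    using \<open>a \<noteq> 0\<close> by (metis mult.assoc mult_1 right_inverse)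
  obtain \<gamma> where "\<gamma> \<in> G"
    using assms by blast
  have isom: "ring_isom \<alpha>" if "\<alpha> \<in> G" for \<alpha>
    using assms(1) that by (auto simp: Aut_def)
  have "(1::'a) = 0"
  proof (rule twisted_hom_independent[OF \<open>finite G\<close> _ _ _ _ \<open>\<gamma> \<in> G\<close>])
    fix \<alpha> :: "'a \<Rightarrow> 'a" and x y assume "\<alpha> \<in> G"
    then interpret ring_isom \<alpha>
      by (rule isom)
    show "\<alpha> (x * y) = \<alpha> x * \<alpha> y" "\<alpha> 1 = 1"
      by (simp_all add: hom_distribs)
  qed (use zero distinct_mod_InnD[OF assms(3,1)] in auto)
  then show False
    by simp
qed

text \<open>Composition with an element of \<open>G\<close> on the left permutes the
  summands.\<close>

lemma trace_fixed:
  fixes G :: "('a::division_ring \<Rightarrow> 'a) set"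
  assumes "subgroup G Aut"
  shows "(\<Sum>\<alpha>\<in>G. \<alpha> x) \<in> fixed_ring G"
  unfolding fixed_ring_def
proof (intro CollectI ballI)
  interpret G: subgroup G Aut
    by (rule assms)
  fix \<beta> assume \<beta>: "\<beta> \<in> G"
  interpret \<beta>: ring_isom \<beta>
    using G.mem_carrier[OF \<beta>] by (simp add: Aut_def)
  have mult: "\<gamma> \<circ> \<alpha> \<in> G" if "\<gamma> \<in> G" "\<alpha> \<in> G" for \<gamma> \<alpha>
    using G.m_closed[OF that] by (simp add: Aut_def)
  interpret Aut: group "Aut :: ('a \<Rightarrow> 'a) monoid"
    by (rule group_Aut)
  let ?\<beta>' = "inv\<^bsub>Aut\<^esub> \<beta>"
  have \<beta>': "?\<beta>' \<in> G" "?\<beta>' \<circ> \<beta> = id" "\<beta> \<circ> ?\<beta>' = id"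
    using G.m_inv_closed[OF \<beta>] Aut.l_inv[of \<beta>] Aut.r_inv[of \<beta>] G.mem_carrier[OF \<beta>]
    by (simp_all add: Aut_def)
  have "\<beta> (\<Sum>\<alpha>\<in>G. \<alpha> x) = (\<Sum>\<alpha>\<in>G. (\<beta> \<circ> \<alpha>) x)"
    by (simp add: \<beta>.hom_sum)
  also have "\<dots> = (\<Sum>\<alpha>\<in>G. \<alpha> x)"
    by (rule sum.reindex_bij_witness[of _ "\<lambda>\<alpha>. ?\<beta>' \<circ> \<alpha>" "\<lambda>\<alpha>. \<beta> \<circ> \<alpha>"])
      (use \<beta> \<beta>' mult in \<open>simp_all add: o_assoc\<close>)
  finally show "\<beta> (\<Sum>\<alpha>\<in>G. \<alpha> x) = (\<Sum>\<alpha>\<in>G. \<alpha> x)" .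
qed

text \<open>Ensures that the quotient of traces solving the covering equation is itself fixed by
  \<open>G\<close>.\<close>

lemma fixed_ring_mult_inverse:
  fixes G :: "('a::division_ring \<Rightarrow> 'a) set"
  assumes G: "G \<subseteq> carrier Aut" and y: "y \<in> fixed_ring G" and z: "z \<in> fixed_ring G" "z \<noteq> 0"
  shows "y * inverse z \<in> fixed_ring G"
  unfolding fixed_ring_def
proof (intro CollectI ballI)
  fix \<alpha> assume \<alpha>: "\<alpha> \<in> G"
  then interpret \<alpha>: ring_isom \<alpha>
    using G by (auto simp: Aut_def)
  have fixed: "\<alpha> y = y" "\<alpha> z = z"
    using \<alpha> y z by (auto simp: fixed_ring_def)
  have "z * \<alpha> (inverse z) = 1"
    using \<alpha>.hom_mult[of z "inverse z"] fixed z(2) by simp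
  then have "\<alpha> (inverse z) = inverse z"
    by (metis inverse_unique)
  then show "\<alpha> (y * inverse z) = y * inverse z"
    by (simp only: \<alpha>.hom_mult fixed)
qed

section \<open>Existence of a good scalar, and its failure over small fixed rings\<close>

text \<open>The second half assumes \<open>G \<noteq> {id}\<close>, which the prose statement does
  not: for the trivial group the sum is the scalar matrix itself, invertible for every nonzero
  scalar even if the ring has fewer than \<open>d\<close> elements. Finiteness is stated separately
  because \<open>card\<close> is 0 on infinite sets.\<close>

theorem theorem8:
  fixes G :: "('a::division_ring \<Rightarrow> 'a) set" and d :: nat
  assumes "subgroup G Aut" and "finite G" and "distinct_mod_Inn G" and "d \<ge> 1"
  shows "(\<forall>C A. one_cocycle G d C \<longrightarrow> A \<in> carrier (GL d) \<longrightarrow> upper_triangular A \<longrightarrow>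
            (\<forall>\<alpha>\<in>G. C \<alpha> = coboundary d A \<alpha>) \<longrightarrow>
            infinite (fixed_ring G) \<or> card (fixed_ring G) \<ge> d \<longrightarrow>
            (\<exists>l. twisted_trace G d C (l \<cdot>\<^sub>m 1\<^sub>m d) \<in> carrier (GL d)))
       \<and> (G \<noteq> {id} \<longrightarrow> finite (fixed_ring G) \<longrightarrow> card (fixed_ring G) < d \<longrightarrow>
            (\<exists>A. A \<in> carrier (GL d) \<and> upper_triangular A \<and>
              (\<forall>l. twisted_trace G d (coboundary d A) (l \<cdot>\<^sub>m 1\<^sub>m d) \<notin> carrier (GL d))))"
proof -
  let ?tr = "\<lambda>x. \<Sum>\<alpha>\<in>G. \<alpha> x"
  let ?F = "fixed_ring G"
  have G: "G \<subseteq> carrier Aut" and id: "id \<in> G"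
    using subgroup.subset[OF assms(1)] subgroup.one_closed[OF assms(1)] by (auto simp: Aut_def)
  have isom: "ring_isom \<alpha>" if "\<alpha> \<in> G" for \<alpha>
    using G that by (auto simp: Aut_def)
  have hom: "\<alpha> (x + y) = \<alpha> x + \<alpha> y" "\<alpha> (x * y) = \<alpha> x * \<alpha> y" "\<alpha> (- x) = - \<alpha> x"
    if "\<alpha> \<in> G" for \<alpha> x y
  proof -
    interpret ring_isom \<alpha>
      using that by (rule isom)
    show "\<alpha> (x + y) = \<alpha> x + \<alpha> y" "\<alpha> (x * y) = \<alpha> x * \<alpha> y" "\<alpha> (- x) = - \<alpha> x"
      by (simp_all add: hom_distribs)
  qed
  have add: "?tr (x + y) = ?tr x + ?tr y" for x y
    by (simp add: hom sum.distrib)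
  have fixed: "\<alpha> f = f" if "f \<in> ?F" "\<alpha> \<in> G" for \<alpha> f
    using that by (auto simp: fixed_ring_def)
  \<comment> \<open>Right linearity serves the avoidance argument, left linearity the covering
    argument.\<close>
  have right: "?tr (x * f) = ?tr x * f" and left: "?tr (f * x) = f * ?tr x" if "f \<in> ?F" for x f
    unfolding sum_distrib_left sum_distrib_right
    by (auto intro!: sum.cong simp: hom fixed[OF that])

  have "\<exists>l. twisted_trace G d C (l \<cdot>\<^sub>m 1\<^sub>m d) \<in> carrier (GL d)"
    if C: "one_cocycle G d C" "\<forall>\<alpha>\<in>G. C \<alpha> = coboundary d A \<alpha>"
      and A: "A \<in> carrier (GL d)" "upper_triangular A" and F: "infinite ?F \<or> card ?F \<ge> d" for C A
  proof -
    have "A $$ (i,i) \<noteq> 0" if "i < d" for i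
      using upper_triangular_GL_iff[OF _ A(2)] A(1) that GL_iff by blast
    then have "\<exists>x. ?tr (inverse (A $$ (i,i)) * x) \<noteq> 0" if "i < d" for i
      using that by (intro trace_nonzero[OF G assms(2,3)]) (use id in auto)
    from avoid_hyperplanes[where T = ?tr and F = ?F and a = "\<lambda>i. inverse (A $$ (i,i))",
        OF add right this F]
    obtain l where "\<forall>i<d. ?tr (inverse (A $$ (i,i)) * l) \<noteq> 0"
      by blast
    then have l: "twisted_trace G d (coboundary d A) (l \<cdot>\<^sub>m 1\<^sub>m d) \<in> carrier (GL d)"
      using twisted_trace_scalar_GL_iff[OF G assms(2) A] by blast
    interpret R: semiring "ring_mat TYPE('a) d ()"
      by (rule semiring_mat)
    \<comment> \<open>Replacing \<open>C\<close> by the coboundary under the ring sum requires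
      summands in the carrier; this comes from the values of the cocycle lying in
      \<open>GL d\<close>.\<close>
    have "coboundary d A \<alpha> \<in> carrier_mat d d" if "\<alpha> \<in> G" for \<alpha>
      using C that by (metis GL_iff PiE one_cocycle_def)
    then have "twisted_trace G d C (l \<cdot>\<^sub>m 1\<^sub>m d) = twisted_trace G d (coboundary d A) (l \<cdot>\<^sub>m 1\<^sub>m d)"
      unfolding twisted_trace_def using C(2)
      by (intro R.finsum_cong') (auto simp: ring_mat_simps intro!: mult_carrier_mat)
    with l show ?thesis
      by metis
  qed
  moreover have "\<exists>A. A \<in> carrier (GL d) \<and> upper_triangular A \<and>
      (\<forall>l. twisted_trace G d (coboundary d A) (l \<cdot>\<^sub>m 1\<^sub>m d) \<notin> carrier (GL d))"
    if nontriv: "G \<noteq> {id}" and F: "finite ?F" "card ?F < d"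
  proof -
    obtain \<alpha> where "\<alpha> \<in> G" "\<alpha> \<noteq> id"
      using nontriv id by blast
    \<comment> \<open>An \<open>x\<close> outside the fixed ring keeps \<open>x + f\<close> nonzero
      for every fixed \<open>f\<close>, so all diagonal entries chosen below are invertible.\<close>
    then obtain x where x: "x \<notin> ?F"
      by (metis eq_id_iff fixed)
    have neg: "- f \<in> ?F" if "f \<in> ?F" for f
      using that by (auto simp: fixed_ring_def hom)
    obtain e where e: "bij_betw e {..<card ?F} ?F"
      using ex_bij_betw_nat_finite[OF F(1)] by (auto simp: atLeast0LessThan)
    \<comment> \<open>The indices below \<open>card ?F\<close> run through all \<open>x + f\<close>.
      Index \<open>card ?F\<close>, which is still below \<open>d\<close>, carries 1 and handles
      every \<open>l\<close> of trace zero.\<close>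
    define a where "a i = (if i < card ?F then x + e i else 1)" for i
    have a: "a i \<noteq> 0" for i
    proof
      assume 0: "a i = 0"
      then have i: "i < card ?F" "x = - e i"
        by (auto simp: a_def eq_neg_iff_add_eq_0 split: if_splits)
      then show False
        using x neg e by (auto simp: bij_betw_def)
    qed
    \<comment> \<open>The diagonal holds inverses because the invertibility criterion inverts the
      diagonal entries again.\<close>
    define A where "A = mat d d (\<lambda>(i,j). if i = j then inverse (a i) else 0)"
    have A: "A \<in> carrier_mat d d" "upper_triangular A"
      by (auto simp: A_def)
    have Aii: "A $$ (i,i) = inverse (a i)" if "i < d" for i
      using that by (simp add: A_def)
    have AG: "A \<in> carrier (GL d)"
      using upper_triangular_GL_iff[OF A] Aii a by simp
    have "\<exists>i<d. ?tr (a i * l) = 0" for l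
    proof (cases "?tr l = 0")
      case True
      then show ?thesis
        using F(2) by (intro exI[of _ "card ?F"]) (simp add: a_def)
    next
      case False
      \<comment> \<open>This is the solution \<open>f\<close> of
        \<open>?tr (x * l) + f * ?tr l = 0\<close>; it is fixed because traces are, so some
        \<open>e i\<close> equals it.\<close>
      have "- (?tr (x * l) * inverse (?tr l)) \<in> ?F"
        by (intro neg fixed_ring_mult_inverse[OF G] trace_fixed[OF assms(1)] False)
      then obtain i where i: "i < card ?F" "e i = - (?tr (x * l) * inverse (?tr l))"
        using e by (metis bij_betw_imp_surj_on imageE lessThan_iff)
      have "e i \<in> ?F"
        using e i(1) by (metis bij_betwE lessThan_iff)
      then have "?tr (a i * l) = ?tr (x * l) + e i * ?tr l"
        using i(1) by (simp only: a_def if_True distrib_right add left)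
      also have "\<dots> = 0"
        using False by (simp add: i mult.assoc)
      finally show ?thesis
        using i F(2) by (intro exI[of _ i]) simp
    qed
    then have "twisted_trace G d (coboundary d A) (l \<cdot>\<^sub>m 1\<^sub>m d) \<notin> carrier (GL d)" for l
      using twisted_trace_scalar_GL_iff[OF G assms(2) AG A(2)] Aii by fastforce
    with AG A(2) show ?thesis
      by blast
  qed
  ultimately show ?thesis
    by blast
qed

end
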